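(* There are infinitely many permutations $\pi$ such that the principal class $\operatorname{Av}(\pi)$ is deflatable.
   Context: A permutation $\alpha$ is contained in $\beta$ if $\beta$ has a subsequence in the same relative order as $\alpha$; a class is a set of permutations closed under taking contained permutations; $\operatorname{Av}(\pi)$ is the (principal) class of permutations not containing $\pi$. An interval of a permutation is a set of entries whose positions and values each form a set of consecutive integers, the whole permutation not counting as an interval; a permutation is simple if all its intervals are single entries (so $1$, $12$, $21$ are simple). A class $\mathcal{C}$ is deflatable if there is a proper subclass $\mathcal{D}\subsetneq\mathcal{C}$ with $\mathcal{C}\subseteq\langle\mathcal{D}\rangle$, where the substitution closure $\langle\mathcal{D}\rangle$ is the largest class whose simple permutations are exactly those of $\mathcal{D}$; equivalently, $\mathcal{C}$ is deflatable if and only if some permutation in $\mathcal{C}$ is not contained in any simple permutation belonging to $\mathcal{C}$. *)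

theory Defs
  imports Main "HOL-Library.Sublist" "HOL-Combinatorics.Multiset_Permutations"
begin

(* Permutations of {1..n}, n \<ge> 1, in one-line notation.  The empty permutation is excluded,
   so that 1 is the smallest permutation. *)
definition perms :: "nat list set" where
  "perms = (\<Union>n\<in>{1..}. permutations_of_set {1..n})"

definition same_order :: "nat list \<Rightarrow> nat list \<Rightarrow> bool" where
  "same_order xs ys \<longleftrightarrow> length xs = length ys \<and>
     (\<forall>i<length xs. \<forall>j<length xs. xs ! i < xs ! j \<longleftrightarrow> ys ! i < ys ! j)"

definition perm_contained :: "nat list \<Rightarrow> nat list \<Rightarrow> bool" where
  "perm_contained \<alpha> \<beta> \<longleftrightarrow> (\<exists>ys. subseq ys \<beta> \<and> same_order \<alpha> ys)"

definition perm_class :: "nat list set \<Rightarrow> bool" where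
  "perm_class C \<longleftrightarrow> C \<subseteq> perms \<and> (\<forall>\<beta>\<in>C. \<forall>\<alpha>\<in>perms. perm_contained \<alpha> \<beta> \<longrightarrow> \<alpha> \<in> C)"

definition Av :: "nat list \<Rightarrow> nat list set" where
  "Av \<pi> = {\<beta>\<in>perms. \<not> perm_contained \<pi> \<beta>}"

(* A set of entries is given by the set I of its (0-based) positions.  Intervals are nonempty and
   proper: the whole permutation does not count. *)
definition perm_interval :: "nat list \<Rightarrow> nat set \<Rightarrow> bool" where
  "perm_interval \<alpha> I \<longleftrightarrow> I \<noteq> {} \<and> I \<subset> {..<length \<alpha>} \<and>
     (\<exists>a b. I = {a..b}) \<and> (\<exists>c d. (\<lambda>i. \<alpha> ! i) ` I = {c..d})"

definition simple_perm :: "nat list \<Rightarrow> bool" where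
  "simple_perm \<alpha> \<longleftrightarrow> \<alpha> \<in> perms \<and> (\<forall>I. perm_interval \<alpha> I \<longrightarrow> card I = 1)"

definition simples :: "nat list set \<Rightarrow> nat list set" where
  "simples C = {\<alpha>\<in>C. simple_perm \<alpha>}"

(* Largest with respect to inclusion; it exists for every class D by the lemmas below. *)
definition subst_closure :: "nat list set \<Rightarrow> nat list set" where
  "subst_closure D = (GREATEST E. perm_class E \<and> simples E = simples D)"

definition deflatable :: "nat list set \<Rightarrow> bool" where
  "deflatable C \<longleftrightarrow> (\<exists>D. perm_class D \<and> D \<subset> C \<and> C \<subseteq> subst_closure D)"

lemma subst_closure_eq_Union:
  assumes "perm_class D"
  shows "subst_closure D = \<Union>{E. perm_class E \<and> simples E = simples D}"
  unfolding subst_closure_def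
proof (rule Greatest_equality)
  let ?S = "{E. perm_class E \<and> simples E = simples D}"
  have "perm_class (\<Union>?S)"
    unfolding perm_class_def by blast
  moreover have "simples (\<Union>?S) = simples D"
  proof
    show "simples (\<Union>?S) \<subseteq> simples D"
      unfolding simples_def by blast
    show "simples D \<subseteq> simples (\<Union>?S)"
      using assms unfolding simples_def by blast
  qed
  ultimately show "perm_class (\<Union>?S) \<and> simples (\<Union>?S) = simples D" ..
qed blast

lemma subst_closure_is_greatest:
  assumes "perm_class D"
  shows "perm_class (subst_closure D)" "simples (subst_closure D) = simples D"
    and "\<And>E. perm_class E \<Longrightarrow> simples E = simples D \<Longrightarrow> E \<subseteq> subst_closure D"
proof -
  have eq: "subst_closure D = \<Union>{E. perm_class E \<and> simples E = simples D}"
    by (rule subst_closure_eq_Union[OF assms])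
  show "perm_class (subst_closure D)"
    unfolding eq perm_class_def by blast
  show "simples (subst_closure D) = simples D"
    using assms unfolding eq simples_def by blast
  show "\<And>E. perm_class E \<Longrightarrow> simples E = simples D \<Longrightarrow> E \<subseteq> subst_closure D"
    unfolding eq by blast
qed

end

theory Submission
  imports Defs
begin

text \<open>
  The class avoiding \<open>\<pi> = 2413[1, 1 2 \<dots> k \<oplus> 213, 1, 1]\<close> is deflatable for every \<open>k \<ge> 1\<close>.
  The permutation 2 9 13 15 5 7 14 1 16 10 11 12 3 6 17 4 8 avoids \<open>2465713\<close>, the case \<open>k = 1\<close>, but
  adding any entry that cuts its interval 11 12 creates a copy of \<open>2465713\<close> in which the entry 4 is
  played neither by the new entry nor by 11 or 12.  So inflate every entry other than 11 and 12 by an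
  increasing sequence of length \<open>2 k\<close>.  Since \<open>2465713\<close> has no increasing interval of more than one
  entry, the inflation still avoids it, and hence \<open>\<pi>\<close>.  In a simple permutation containing the
  inflation, some entry cuts the rectangular hull of 11 and 12.  That entry may also split other
  blocks, but each keeps an unsplit half of length \<open>k\<close>, and the half that plays the entry 4 completes
  a copy of \<open>\<pi>\<close>.
\<close>

section \<open>Containment\<close>

lemma subseq_set: "subseq xs ys \<Longrightarrow> set xs \<subseteq> set ys"
  by (induction rule: list_emb.induct) auto

lemma sorted_wrt_subseq:
  assumes "subseq xs ys" "sorted_wrt R ys"
  shows "sorted_wrt R xs"
  using assms by (induction rule: list_emb.induct) (auto dest: subseq_set)

lemma subseq_map_right:
  assumes "subseq ys (map f xs)"
  shows "\<exists>zs. subseq zs xs \<and> ys = map f zs"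
  using assms
proof (induction xs arbitrary: ys)
  case (Cons x xs)
  show ?case
  proof (cases "subseq ys (map f xs)")
    case True
    then show ?thesis using Cons.IH by blast
  next
    case False
    then obtain ys' where "ys = f x # ys'" "subseq ys' (map f xs)"
      using Cons.prems by (cases ys) (auto split: if_splits)
    then obtain zs where "subseq zs xs" "ys' = map f zs"
      using Cons.IH by blast
    then have "subseq (x # zs) (x # xs)" "ys = map f (x # zs)"
      using \<open>ys = f x # ys'\<close> by auto
    then show ?thesis by blast
  qed
qed auto

text \<open>Both directions pass through \<open>xs = map ((!) xs) [0..<length xs]\<close>: the
  subsequences of the index list are the strictly increasing lists of indices.\<close>

lemma subseq_iff_positions:
  "subseq ys xs \<longleftrightarrow>
    (\<exists>ps. sorted_wrt (<) ps \<and> set ps \<subseteq> {..<length xs} \<and> ys = map ((!) xs) ps)"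
proof
  assume "subseq ys xs"
  then have "subseq ys (map ((!) xs) [0..<length xs])"
    by (simp add: map_nth)
  then obtain ps where ps: "subseq ps [0..<length xs]" "ys = map ((!) xs) ps"
    using subseq_map_right by blast
  then have "sorted_wrt (<) ps" "set ps \<subseteq> {..<length xs}"
    using sorted_wrt_subseq[OF ps(1)] subseq_set[OF ps(1)] by auto
  with ps(2) show "\<exists>ps. sorted_wrt (<) ps \<and> set ps \<subseteq> {..<length xs} \<and> ys = map ((!) xs) ps"
    by blast
next
  assume "\<exists>ps. sorted_wrt (<) ps \<and> set ps \<subseteq> {..<length xs} \<and> ys = map ((!) xs) ps"
  then obtain ps where ps: "sorted_wrt (<) ps" "set ps \<subseteq> {..<length xs}" "ys = map ((!) xs) ps"
    by blast
  have "subseq ps [0..<length xs]"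
    using ps(1,2) by (intro sorted_subset_imp_subseq) (auto simp: strict_sorted_iff)
  then have "subseq (map ((!) xs) ps) (map ((!) xs) [0..<length xs])"
    by (rule subseq_map)
  then show "subseq ys xs"
    using ps(3) by (simp add: map_nth)
qed

lemma ex_map_eq:
  assumes "distinct xs" "length xs = length ys"
  shows "\<exists>f. map f xs = ys"
proof
  show "map (\<lambda>x. the (map_of (zip xs ys) x)) xs = ys"
    using assms by (intro nth_equalityI) (auto simp: map_of_zip_nth)
qed

text \<open>An embedding is encoded as a function \<phi> from the entries of \<alpha> to positions
  in \<beta>: sortedness of \<phi> along \<alpha> keeps the order of positions, strict monotonicity
  the order of values. In this form an embedding can be applied block by block.\<close>

lemma perm_contained_iff:
  assumes "distinct \<alpha>"
  shows "perm_contained \<alpha> \<beta> \<longleftrightarrow>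
    (\<exists>\<phi>. sorted_wrt (<) (map \<phi> \<alpha>) \<and> \<phi> ` set \<alpha> \<subseteq> {..<length \<beta>} \<and>
      strict_mono_on (set \<alpha>) (\<lambda>v. \<beta> ! \<phi> v))"
proof
  assume "perm_contained \<alpha> \<beta>"
  then obtain ps where ps: "sorted_wrt (<) ps" "set ps \<subseteq> {..<length \<beta>}"
      and so: "same_order \<alpha> (map ((!) \<beta>) ps)"
    unfolding perm_contained_def subseq_iff_positions by blast
  have len: "length \<alpha> = length ps"
    using so by (simp add: same_order_def)
  then obtain \<phi> where \<phi>: "map \<phi> \<alpha> = ps"
    using ex_map_eq assms by blast
  have "strict_mono_on (set \<alpha>) (\<lambda>v. \<beta> ! \<phi> v)"
    using so unfolding \<phi>[symmetric]
    by (auto simp: strict_mono_on_def same_order_def in_set_conv_nth)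
  moreover have "\<phi> ` set \<alpha> = set ps"
    unfolding \<phi>[symmetric] by simp
  ultimately show "\<exists>\<phi>. sorted_wrt (<) (map \<phi> \<alpha>) \<and> \<phi> ` set \<alpha> \<subseteq> {..<length \<beta>} \<and>
      strict_mono_on (set \<alpha>) (\<lambda>v. \<beta> ! \<phi> v)"
    using ps \<phi> by metis
next
  assume "\<exists>\<phi>. sorted_wrt (<) (map \<phi> \<alpha>) \<and> \<phi> ` set \<alpha> \<subseteq> {..<length \<beta>} \<and>
      strict_mono_on (set \<alpha>) (\<lambda>v. \<beta> ! \<phi> v)"
  then obtain \<phi> where \<phi>: "sorted_wrt (<) (map \<phi> \<alpha>)" "\<phi> ` set \<alpha> \<subseteq> {..<length \<beta>}"
      "strict_mono_on (set \<alpha>) (\<lambda>v. \<beta> ! \<phi> v)"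
    by blast
  have "subseq (map (\<lambda>v. \<beta> ! \<phi> v) \<alpha>) \<beta>"
    unfolding subseq_iff_positions using \<phi>(1,2)
    by (intro exI[of _ "map \<phi> \<alpha>"]) auto
  moreover have "same_order \<alpha> (map (\<lambda>v. \<beta> ! \<phi> v) \<alpha>)"
    using strict_mono_on_less[OF \<phi>(3)] by (auto simp: same_order_def)
  ultimately show "perm_contained \<alpha> \<beta>"
    unfolding perm_contained_def by blast
qed

lemma same_order_sym: "same_order xs ys \<Longrightarrow> same_order ys xs"
  by (simp add: same_order_def)

lemma same_order_trans: "same_order xs ys \<Longrightarrow> same_order ys zs \<Longrightarrow> same_order xs zs"
  by (simp add: same_order_def)

lemma perm_contained_same_order: "same_order \<alpha> \<beta> \<Longrightarrow> perm_contained \<alpha> \<beta>"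
  unfolding perm_contained_def by blast

lemma perm_contained_refl: "perm_contained \<alpha> \<alpha>"
  by (rule perm_contained_same_order) (simp add: same_order_def)

lemma perm_contained_trans:
  assumes "perm_contained \<alpha> \<beta>" "perm_contained \<beta> \<gamma>"
  shows "perm_contained \<alpha> \<gamma>"
proof -
  obtain ps where ps: "sorted_wrt (<) ps" "set ps \<subseteq> {..<length \<beta>}"
      and \<alpha>: "same_order \<alpha> (map ((!) \<beta>) ps)"
    using assms(1) unfolding perm_contained_def subseq_iff_positions by blast
  obtain zs where zs: "subseq zs \<gamma>" "same_order \<beta> zs"
    using assms(2) unfolding perm_contained_def by blast
  have len: "length \<beta> = length zs"
    using zs(2) by (simp add: same_order_def)
  have "subseq (map ((!) zs) ps) zs"
    unfolding subseq_iff_positions using ps len by auto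
  moreover have "same_order (map ((!) \<beta>) ps) (map ((!) zs) ps)"
    using zs(2) ps(2) unfolding same_order_def by (auto simp: subset_iff)
  ultimately show ?thesis
    unfolding perm_contained_def
    using zs(1) \<alpha> same_order_trans subseq_order.order_trans by blast
qed

section \<open>Permutations and standardization\<close>

lemma perms_iff: "\<alpha> \<in> perms \<longleftrightarrow> \<alpha> \<noteq> [] \<and> distinct \<alpha> \<and> set \<alpha> = {1..length \<alpha>}"
proof
  assume "\<alpha> \<in> perms"
  then obtain n where n: "n \<ge> 1" "set \<alpha> = {1..n}" "distinct \<alpha>"
    by (auto simp: perms_def permutations_of_set_def)
  then have "length \<alpha> = n"
    using distinct_card by fastforce
  then show "\<alpha> \<noteq> [] \<and> distinct \<alpha> \<and> set \<alpha> = {1..length \<alpha>}"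
    using n by auto
next
  assume *: "\<alpha> \<noteq> [] \<and> distinct \<alpha> \<and> set \<alpha> = {1..length \<alpha>}"
  then have "length \<alpha> \<ge> 1"
    by (cases \<alpha>) auto
  with * show "\<alpha> \<in> perms"
    unfolding perms_def permutations_of_set_def by blast
qed

text \<open>Each entry is replaced by its rank, the number of entries not exceeding it. The
  inflation below needs this, since its entries leave gaps.\<close>

lemma ex_standardization:
  fixes xs :: "nat list"
  assumes "distinct xs" "xs \<noteq> []"
  shows "\<exists>\<alpha>\<in>perms. same_order \<alpha> xs"
proof
  define rk where "rk x = card {y\<in>set xs. y \<le> x}" for x
  have mono: "rk x < rk y" if "x \<in> set xs" "y \<in> set xs" "x < y" for x y
  proof -
    have "insert y {z\<in>set xs. z \<le> x} \<subseteq> {z\<in>set xs. z \<le> y}"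
      using that by auto
    then have "card (insert y {z\<in>set xs. z \<le> x}) \<le> rk y"
      unfolding rk_def by (intro card_mono) auto
    then show ?thesis
      using that by (simp add: rk_def)
  qed
  then have iff: "rk x < rk y \<longleftrightarrow> x < y" if "x \<in> set xs" "y \<in> set xs" for x y
    using that by (metis less_asym nat_neq_iff)
  have inj: "inj_on rk (set xs)"
    using mono by (metis inj_onI less_irrefl nat_neq_iff)
  have "rk x \<in> {1..length xs}" if "x \<in> set xs" for x
  proof -
    have "rk x \<le> card (set xs)"
      unfolding rk_def by (intro card_mono) auto
    moreover have "rk x > 0"
      unfolding rk_def using that by (auto simp: card_gt_0_iff)
    ultimately show ?thesis
      using distinct_card[OF assms(1)] by simp
  qed
  then have "rk ` set xs = {1..length xs}"
    using inj by (intro card_subset_eq) (auto simp: card_image distinct_card[OF assms(1)])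
  then show "map rk xs \<in> perms"
    using assms inj by (auto simp: perms_iff distinct_map)
  show "same_order (map rk xs) xs"
    using iff by (auto simp: same_order_def)
qed

section \<open>Deflatability and entries that cut an interval\<close>

lemma perm_class_Av: "perm_class (Av \<pi>)"
  unfolding perm_class_def
proof (intro conjI ballI impI)
  fix \<beta> \<alpha> assume "\<beta> \<in> Av \<pi>" "\<alpha> \<in> perms" "perm_contained \<alpha> \<beta>"
  then show "\<alpha> \<in> Av \<pi>"
    using perm_contained_trans[of \<pi> \<alpha> \<beta>] by (auto simp: Av_def)
qed (auto simp: Av_def)

text \<open>The downward closure \<open>D\<close> of the simple permutations of \<open>C\<close> has
  the same simple permutations as \<open>C\<close>, so \<open>C\<close> lies below
  \<open>subst_closure D\<close>. It is a proper subclass because it omits \<sigma>.\<close>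

lemma deflatableI:
  assumes "perm_class C" "\<sigma> \<in> C"
    and "\<And>\<tau>. \<tau> \<in> simples C \<Longrightarrow> \<not> perm_contained \<sigma> \<tau>"
  shows "deflatable C"
proof -
  define D where "D = {\<alpha>\<in>perms. \<exists>\<tau>\<in>simples C. perm_contained \<alpha> \<tau>}"
  have sub: "C \<subseteq> perms" and closed: "\<And>\<alpha> \<beta>. \<beta> \<in> C \<Longrightarrow> \<alpha> \<in> perms \<Longrightarrow> perm_contained \<alpha> \<beta> \<Longrightarrow> \<alpha> \<in> C"
    using assms(1) unfolding perm_class_def by auto
  have D: "perm_class D"
    unfolding perm_class_def
  proof (intro conjI ballI impI)
    fix \<beta> \<alpha> assume "\<beta> \<in> D" "\<alpha> \<in> perms" "perm_contained \<alpha> \<beta>"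
    then show "\<alpha> \<in> D"
      using perm_contained_trans[of \<alpha> \<beta>] by (auto simp: D_def)
  qed (auto simp: D_def)
  have "D \<subseteq> C"
    using closed by (auto simp: D_def simples_def)
  moreover have "\<sigma> \<notin> D"
    using assms(3) by (auto simp: D_def)
  moreover have "simples C = simples D"
  proof
    show "simples C \<subseteq> simples D"
      using sub perm_contained_refl by (auto simp: D_def simples_def)
    show "simples D \<subseteq> simples C"
      using \<open>D \<subseteq> C\<close> by (auto simp: simples_def)
  qed
  ultimately show ?thesis
    unfolding deflatable_def
    using D subst_closure_is_greatest(3)[OF D assms(1)] assms(2) by blast
qed

text \<open>If no entry cut the rectangle spanned by the entries at \<open>x\<close> and
  \<open>y\<close>, it would hold an interval of more than one entry, proper because of
  \<open>z\<close>. The first case cuts the rectangle in position, the second in value.\<close>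

lemma simple_perm_cut:
  assumes "simple_perm \<tau>" "x < y" "y < length \<tau>" "\<tau> ! x < \<tau> ! y"
    and "z < length \<tau>" "z \<notin> {x..y}"
  obtains p where "x < p" "p < y" "\<tau> ! p < \<tau> ! x \<or> \<tau> ! y < \<tau> ! p"
  | p where "p < length \<tau>" "\<tau> ! x < \<tau> ! p" "\<tau> ! p < \<tau> ! y" "p < x \<or> y < p"
proof (rule ccontr)
  assume "\<not> thesis"
  then have pos: "\<And>p. x < p \<Longrightarrow> p < y \<Longrightarrow> \<tau> ! x \<le> \<tau> ! p \<and> \<tau> ! p \<le> \<tau> ! y"
    and val: "\<And>p. p < length \<tau> \<Longrightarrow> \<tau> ! x < \<tau> ! p \<Longrightarrow> \<tau> ! p < \<tau> ! y \<Longrightarrow> x \<le> p \<and> p \<le> y"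
    using that by (meson not_le)+
  have set: "set \<tau> = {1..length \<tau>}"
    using assms(1) by (simp add: simple_perm_def perms_iff)
  have "(\<lambda>i. \<tau> ! i) ` {x..y} = {\<tau> ! x..\<tau> ! y}"
  proof
    show "(\<lambda>i. \<tau> ! i) ` {x..y} \<subseteq> {\<tau> ! x..\<tau> ! y}"
    proof
      fix v assume "v \<in> (\<lambda>i. \<tau> ! i) ` {x..y}"
      then obtain i where "x \<le> i" "i \<le> y" "v = \<tau> ! i" by auto
      then show "v \<in> {\<tau> ! x..\<tau> ! y}"
        using pos[of i] assms(4) by (cases "i = x \<or> i = y") auto
    qed
    \<comment> \<open>A permutation misses no value in between, and without a cut each such value
      sits between \<open>x\<close> and \<open>y\<close>.\<close>
    show "{\<tau> ! x..\<tau> ! y} \<subseteq> (\<lambda>i. \<tau> ! i) ` {x..y}"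
    proof
      fix v assume v: "v \<in> {\<tau> ! x..\<tau> ! y}"
      have "\<tau> ! x \<in> set \<tau>" "\<tau> ! y \<in> set \<tau>"
        using assms(2,3) by auto
      then have "v \<in> set \<tau>"
        using v set by auto
      then obtain p where p: "p < length \<tau>" "v = \<tau> ! p"
        by (auto simp: in_set_conv_nth)
      show "v \<in> (\<lambda>i. \<tau> ! i) ` {x..y}"
      proof (cases "v = \<tau> ! x \<or> v = \<tau> ! y")
        case True
        then show ?thesis using assms(2) by auto
      next
        case False
        then have "x \<le> p \<and> p \<le> y"
          using val[of p] p v by auto
        then show ?thesis using p by auto
      qed
    qed
  qed
  moreover have "{x..y} \<subseteq> {..<length \<tau>}" "z \<in> {..<length \<tau>}"
    using assms(3,5) by auto
  then have "{x..y} \<subset> {..<length \<tau>}"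
    using assms(6) by blast
  moreover have "{x..y} \<noteq> {}"
    using assms(2) by simp
  ultimately have "perm_interval \<tau> {x..y}"
    unfolding perm_interval_def by blast
  then have "card {x..y} = 1"
    using assms(1) unfolding simple_perm_def by blast
  then show False
    using assms(2) by simp
qed

section \<open>Inflations as sequences of blocks\<close>

lemma sorted_wrt_concat_map:
  "sorted_wrt R (concat (map B L)) \<longleftrightarrow>
    (\<forall>v\<in>set L. sorted_wrt R (B v)) \<and>
    sorted_wrt (\<lambda>v w. \<forall>x\<in>set (B v). \<forall>y\<in>set (B w). R x y) L"
  by (induction L) (auto simp: sorted_wrt_append)

section \<open>The pattern and its occurrences made of blocks\<close>

definition pattern :: "nat \<Rightarrow> nat list" where
  "pattern k = 2 # [4..<4 + k] @ [k + 5, k + 4, k + 6, 1, 3]"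

lemma pattern_in_perms: "pattern k \<in> perms"
  by (auto simp: perms_iff pattern_def)

text \<open>By position, \<open>a\<close> plays 2, \<open>G\<close> the run from 4 to k + 3, and
  \<open>r\<close>, \<open>s\<close>, \<open>u\<close>, \<open>b\<close>, \<open>c\<close> play k +
  5, k + 4, k + 6, 1, 3. The second assumption lists the same letters by value.\<close>

lemma perm_contained_pattern:
  assumes pos: "sorted_wrt (<) (a # G @ [r, s, u, b, c])"
    and val: "sorted_wrt (<) (map ((!) \<tau>) (b # a # c # G @ [s, r, u]))"
    and len: "length G = k" and sub: "set (a # G @ [r, s, u, b, c]) \<subseteq> {..<length \<tau>}"
  shows "perm_contained (pattern k) \<tau>"
proof -
  define zs where "zs = b # a # c # G @ [s, r, u]"
  \<comment> \<open>\<open>zs\<close> is ordered by value and entries count from 1, hence the index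
    \<open>v - 1\<close>.\<close>
  define \<phi> where "\<phi> v = zs ! (v - 1)" for v
  have len_zs: "length zs = k + 6"
    by (simp add: zs_def len)
  have set_pattern: "set (pattern k) = {1..k + 6}"
    using pattern_in_perms[of k] unfolding perms_iff by (simp add: pattern_def)
  have nth: "\<phi> (4 + i) = (G @ [s, r, u]) ! i" for i
    by (simp add: \<phi>_def zs_def nth_Cons')
  have "map \<phi> [4..<4 + k] = G"
    using len by (intro nth_equalityI) (auto simp: nth nth_append)
  moreover have "\<phi> (k + 4) = s" "\<phi> (k + 5) = r" "\<phi> (k + 6) = u"
    using nth[of k] nth[of "k + 1"] nth[of "k + 2"] len by (simp_all add: nth_append add.commute)
  moreover have "\<phi> 1 = b" "\<phi> 2 = a" "\<phi> 3 = c"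
    by (simp_all add: \<phi>_def zs_def nth_Cons')
  ultimately have "map \<phi> (pattern k) = a # G @ [r, s, u, b, c]"
    by (simp add: pattern_def)
  moreover from this have "\<phi> ` set (pattern k) \<subseteq> {..<length \<tau>}"
    using sub by (metis set_map)
  moreover have "strict_mono_on (set (pattern k)) (\<lambda>v. \<tau> ! \<phi> v)"
  proof (rule strict_mono_onI)
    fix v w assume "v \<in> set (pattern k)" "w \<in> set (pattern k)" "v < w"
    then have "v - 1 < w - 1" "w - 1 < length zs"
      by (auto simp: set_pattern len_zs)
    then show "\<tau> ! \<phi> v < \<tau> ! \<phi> w"
      using val unfolding zs_def[symmetric] \<phi>_def sorted_wrt_iff_nth_less by auto
  qed
  moreover have "distinct (pattern k)"
    using pattern_in_perms[of k] by (simp add: perms_iff)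
  ultimately show ?thesis
    unfolding perm_contained_iff[OF \<open>distinct (pattern k)\<close>] using pos by metis
qed

text \<open>The whole block of \<open>q\<close> plays the run, and the head of each other block
  plays a single entry. Both sorted concatenations give the order inside \<open>B q\<close> and
  between blocks.\<close>

lemma perm_contained_pattern_blocks:
  assumes pos: "sorted_wrt (<) (concat (map B P))"
    and val: "sorted_wrt (<) (map ((!) \<tau>) (concat (map B V)))"
    and sub: "subseq [a, q, r, s, u, b, c] P" "subseq [b, a, c, q, s, r, u] V"
    and ne: "\<And>v. v \<in> set P \<Longrightarrow> B v \<noteq> []"
    and bd: "\<And>v. v \<in> set P \<Longrightarrow> set (B v) \<subseteq> {..<length \<tau>}"
    and len: "length (B q) = k"
  shows "perm_contained (pattern k) \<tau>"
proof -
  have inP: "{a, q, r, s, u, b, c} \<subseteq> set P"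
    using subseq_set[OF sub(1)] by simp
  have val': "sorted_wrt (\<lambda>x y. \<tau> ! x < \<tau> ! y) (concat (map B V))"
    using val by (simp add: sorted_wrt_map)
  have hd: "hd (B v) \<in> set (B v)" if "v \<in> {a, q, r, s, u, b, c}" for v
    using ne[of v] inP that by auto
  have less: "hd (B v) < length \<tau>" if "v \<in> {a, q, r, s, u, b, c}" for v
    using bd[of v] hd[OF that] inP that by auto
  have "sorted_wrt (\<lambda>v w. \<forall>x\<in>set (B v). \<forall>y\<in>set (B w). x < y) [a, q, r, s, u, b, c]"
    using sorted_wrt_subseq[OF sub(1)] pos unfolding sorted_wrt_concat_map by blast
  moreover have "sorted_wrt (\<lambda>v w. \<forall>x\<in>set (B v). \<forall>y\<in>set (B w). \<tau> ! x < \<tau> ! y) [b, a, c, q, s, r, u]"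
    using sorted_wrt_subseq[OF sub(2)] val' unfolding sorted_wrt_concat_map by blast
  moreover have "sorted_wrt (<) (B q)"
    using inP pos unfolding sorted_wrt_concat_map by auto
  moreover have "q \<in> set V"
    using subseq_set[OF sub(2)] by simp
  then have "sorted_wrt (\<lambda>x y. \<tau> ! x < \<tau> ! y) (B q)"
    using val' unfolding sorted_wrt_concat_map by auto
  moreover have "hd (B a) \<in> set (B a)" "hd (B r) \<in> set (B r)" "hd (B s) \<in> set (B s)"
    "hd (B u) \<in> set (B u)" "hd (B b) \<in> set (B b)" "hd (B c) \<in> set (B c)"
    by (intro hd; simp)+
  ultimately have P: "sorted_wrt (<) (hd (B a) # B q @ [hd (B r), hd (B s), hd (B u), hd (B b), hd (B c)])"
    and V: "sorted_wrt (<) (map ((!) \<tau>) (hd (B b) # hd (B a) # hd (B c) # B q @ [hd (B s), hd (B r), hd (B u)]))"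
    by (simp_all add: sorted_wrt_append sorted_wrt_map)
  have "set (hd (B a) # B q @ [hd (B r), hd (B s), hd (B u), hd (B b), hd (B c)]) \<subseteq> {..<length \<tau>}"
    using less inP bd[of q] by simp
  then show ?thesis
    by (rule perm_contained_pattern[OF P V len])
qed

text \<open>The label 0, which no entry of the skeleton below carries, marks the cutting entry.\<close>

definition insert_pin :: "nat list \<Rightarrow> nat \<Rightarrow> nat list" where
  "insert_pin L c = take c L @ [0] @ drop c L"

lemma sorted_wrt_shrink_blocks:
  assumes "sorted_wrt R (concat (map B L))" "\<And>v. v \<in> set L \<Longrightarrow> set (B' v) \<subseteq> set (B v)"
    and "\<And>v. v \<in> set L \<Longrightarrow> sorted_wrt R (B' v)"
  shows "sorted_wrt R (concat (map B' L))"
  unfolding sorted_wrt_concat_map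
proof (intro conjI ballI)
  show "sorted_wrt (\<lambda>v w. \<forall>x\<in>set (B' v). \<forall>y\<in>set (B' w). R x y) L"
  proof (rule sorted_wrt_mono_rel)
    show "sorted_wrt (\<lambda>v w. \<forall>x\<in>set (B v). \<forall>y\<in>set (B w). R x y) L"
      using assms(1) unfolding sorted_wrt_concat_map by blast
  qed (use assms(2) in blast)
qed (use assms(3) in auto)

text \<open>Serves for the order of positions and for that of values, so that the cutting entry
  becomes a singleton block in both lists.\<close>

lemma insert_pin_sorted:
  assumes "sorted_wrt R (concat (map B L))" "0 \<notin> set L"
    and "\<And>v x. v \<in> set (take c L) \<Longrightarrow> x \<in> set (B v) \<Longrightarrow> R x p"
    and "\<And>v x. v \<in> set (drop c L) \<Longrightarrow> x \<in> set (B v) \<Longrightarrow> R p x"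
  shows "sorted_wrt R (concat (map (B(0 := [p])) (insert_pin L c)))"
proof -
  have "0 \<notin> set (take c L)" "0 \<notin> set (drop c L)"
    using assms(2) by (auto dest: in_set_takeD in_set_dropD)
  then have "map (B(0 := [p])) (take c L) = map B (take c L)"
    "map (B(0 := [p])) (drop c L) = map B (drop c L)"
    by simp_all
  moreover have "concat (map B L) = concat (map B (take c L)) @ concat (map B (drop c L))"
    by (metis append_take_drop_id concat_append map_append)
  ultimately show ?thesis
    using assms(1,3,4)
    by (simp add: insert_pin_def sorted_wrt_append del: map_fun_upd map_eq_conv)
qed

text \<open>Here \<kappa> is one coordinate, value or position, and \<open>p\<close> the cutting
  entry. A block of length \<open>2 * k\<close> increases in \<kappa>, so its entry at index
  \<open>k\<close> decides which half lies wholly on one side of \<open>p\<close>. The blocks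
  increase as well, so those below \<open>p\<close> form an initial segment, whose length is
  \<open>c\<close>.\<close>

lemma split_blocks:
  fixes \<kappa> :: "nat \<Rightarrow> nat"
  assumes sorted: "sorted_wrt (\<lambda>x y. \<kappa> x < \<kappa> y) (concat (map B L))" and "k \<ge> 1"
    and len: "\<And>v. v \<in> set L \<Longrightarrow> length (B v) = 1 \<or> length (B v) = 2 * k"
    and neq: "\<And>v x. v \<in> set L \<Longrightarrow> x \<in> set (B v) \<Longrightarrow> \<kappa> x \<noteq> \<kappa> p"
  obtains B' c where
    "c \<le> length L"
    "\<And>v. v \<in> set L \<Longrightarrow> subseq (B' v) (B v)"
    "\<And>v. v \<in> set L \<Longrightarrow> B' v \<noteq> []"
    "\<And>v. v \<in> set L \<Longrightarrow> length (B v) \<noteq> 1 \<Longrightarrow> length (B' v) = k"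
    "\<And>v x. v \<in> set (take c L) \<Longrightarrow> x \<in> set (B' v) \<Longrightarrow> \<kappa> x < \<kappa> p"
    "\<And>v x. v \<in> set (drop c L) \<Longrightarrow> x \<in> set (B' v) \<Longrightarrow> \<kappa> p < \<kappa> x"
proof -
  define B' where "B' v = (if length (B v) = 1 then B v
    else if \<kappa> p < \<kappa> (B v ! k) then drop k (B v) else take k (B v))" for v
  define below where "below v \<longleftrightarrow> (\<forall>x\<in>set (B' v). \<kappa> x < \<kappa> p)" for v
  define c where "c = length (takeWhile below L)"
  have sub: "subseq (B' v) (B v)" for v
    by (auto simp: B'_def intro: prefix_imp_subseq take_is_prefix suffix_imp_subseq suffix_drop)
  have ne: "B' v \<noteq> []" if "v \<in> set L" for v
    using len[OF that] \<open>k \<ge> 1\<close> by (auto simp: B'_def)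
  have one_side: "below v \<or> (\<forall>x\<in>set (B' v). \<kappa> p < \<kappa> x)" if "v \<in> set L" for v
  proof (cases "length (B v) = 1")
    case True
    then obtain x where "B v = [x]"
      by (auto simp: length_Suc_conv)
    then show ?thesis
      using neq[OF that, of x] by (auto simp: below_def B'_def)
  next
    case False
    then have l: "length (B v) = 2 * k"
      using len[OF that] by blast
    have mono: "\<kappa> (B v ! i) < \<kappa> (B v ! j)" if "i < j" "j < 2 * k" for i j
    proof -
      have "sorted_wrt (\<lambda>x y. \<kappa> x < \<kappa> y) (B v)"
        using sorted \<open>v \<in> set L\<close> unfolding sorted_wrt_concat_map by blast
      then show ?thesis
        using l that unfolding sorted_wrt_iff_nth_less by auto
    qed
    have mid: "\<kappa> (B v ! k) \<noteq> \<kappa> p"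
      using neq[OF that] l \<open>k \<ge> 1\<close> by auto
    show ?thesis
    proof (cases "\<kappa> p < \<kappa> (B v ! k)")
      case True
      have "\<kappa> p < \<kappa> x" if x: "x \<in> set (drop k (B v))" for x
      proof -
        obtain i where "i < length (drop k (B v))" "x = drop k (B v) ! i"
          using x unfolding in_set_conv_nth by blast
        then have "i < k" "x = B v ! (k + i)"
          using l by simp_all
        then show ?thesis
          using True mono[of k "k + i"] by (cases "i = 0") auto
      qed
      then show ?thesis
        using True False by (auto simp: B'_def)
    next
      case gt: False
      have "\<kappa> x < \<kappa> p" if x: "x \<in> set (take k (B v))" for x
      proof -
        obtain i where "i < k" "x = B v ! i"
          using x l by (auto simp: in_set_conv_nth)
        then show ?thesis
          using gt mid mono[of i k] by auto
      qed
      then show ?thesis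
        using gt False by (auto simp: B'_def below_def)
    qed
  qed
  have LR: "take c L = takeWhile below L" "drop c L = dropWhile below L"
    unfolding c_def by (simp_all add: takeWhile_eq_take[symmetric] dropWhile_eq_drop[symmetric])
  \<comment> \<open>The first block \<open>w\<close> after the cut is not below \<open>p\<close>,
    hence above it, and all later blocks are above \<open>w\<close>.\<close>
  have right: "\<kappa> p < \<kappa> x" if v: "v \<in> set (drop c L)" and x: "x \<in> set (B' v)" for v x
  proof (cases "drop c L")
    case (Cons w ws)
    then have "\<not> below w"
      unfolding LR by (metis hd_dropWhile list.distinct(1) list.sel(1))
    have wL: "w \<in> set L" "v \<in> set L"
      using Cons v by (auto intro: in_set_dropD[of _ c])
    then have w: "\<forall>y\<in>set (B' w). \<kappa> p < \<kappa> y"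
      using one_side \<open>\<not> below w\<close> by blast
    obtain y where y: "y \<in> set (B' w)"
      using list.set_sel(1)[OF ne[OF wL(1)]] by blast
    show ?thesis
    proof (cases "v = w")
      case False
      then have "v \<in> set ws"
        using v Cons by simp
      moreover have "sorted_wrt (\<lambda>v w. \<forall>x\<in>set (B v). \<forall>y\<in>set (B w). \<kappa> x < \<kappa> y) L"
        using sorted unfolding sorted_wrt_concat_map by blast
      then have "sorted_wrt (\<lambda>v w. \<forall>x\<in>set (B v). \<forall>y\<in>set (B w). \<kappa> x < \<kappa> y) (w # ws)"
        unfolding Cons[symmetric] by (rule sorted_wrt_drop)
      ultimately have "\<kappa> y < \<kappa> x"
        using x y subseq_set[OF sub, of v] subseq_set[OF sub, of w] by (auto simp: subset_iff)
      then show ?thesis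
        using w y by fastforce
    qed (use w x in blast)
  qed (use v in auto)
  have left: "\<kappa> x < \<kappa> p" if "v \<in> set (take c L)" "x \<in> set (B' v)" for v x
    using that unfolding LR by (auto dest: set_takeWhileD simp: below_def)
  have "length (B' v) = k" if "v \<in> set L" "length (B v) \<noteq> 1" for v
    using len[OF that(1)] that(2) by (auto simp: B'_def)
  then show ?thesis
    using that[of c B'] sub ne left right by (auto simp: c_def length_takeWhile_le)
qed


section \<open>A permutation contained in no simple permutation avoiding the pattern\<close>

definition skeleton :: "nat list" where
  "skeleton = [2, 9, 13, 15, 5, 7, 14, 1, 16, 10, 11, 12, 3, 6, 17, 4, 8]"

text \<open>Starting block \<open>v\<close> at \<open>2 * k * v\<close> makes division by
  \<open>2 * k\<close> recover the label, and blocks are ordered by value as their labels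
  are.\<close>

definition block :: "nat \<Rightarrow> nat \<Rightarrow> nat list" where
  "block k v = [2 * k * v ..< 2 * k * v + (if v = 11 \<or> v = 12 then 1 else 2 * k)]"

definition inflation :: "nat \<Rightarrow> nat list" where
  "inflation k = concat (map (block k) skeleton)"

lemma upt_18: "[1..<18] = [1, 2, 3, 4, 5, 6, 7, 8, 9, 10, 11, 12, 13, 14, 15, 16, 17]"
  by (simp add: upt_rec)

lemma set_skeleton: "set skeleton = {1..<18}"
  unfolding set_upt[symmetric] upt_18 by (auto simp: skeleton_def)

text \<open>
  \<open>P\<close> and \<open>V\<close> list the blocks by position and by value; the block \<open>q\<close> plays the entries
  \<open>4, \<dots>, k + 3\<close> of the pattern, every other label a single entry.
\<close>

definition pattern_labels :: "nat list \<Rightarrow> nat list \<Rightarrow> bool" where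
  "pattern_labels P V \<longleftrightarrow> (\<exists>a q r s u b c. q \<notin> {0, 11, 12} \<and>
    subseq [a, q, r, s, u, b, c] P \<and> subseq [b, a, c, q, s, r, u] V)"

lemma pattern_labelsI:
  "q \<notin> {0, 11, 12} \<Longrightarrow> subseq [a, q, r, s, u, b, c] P \<Longrightarrow> subseq [b, a, c, q, s, r, u] V \<Longrightarrow>
    pattern_labels P V"
  unfolding pattern_labels_def by blast

text \<open>The witnesses in the next two lemmas were found by a computer search.\<close>

lemma pattern_labels_vertical:
  assumes "c \<le> 17" "c \<noteq> 11"
  shows "pattern_labels (insert_pin skeleton 11) (insert_pin [1..<18] c)"
proof -
  \<comment> \<open>\<open>c\<close> counts the labels below the cutting entry in value. At 11 that
    entry would lie between 11 and 12 in both coordinates and cut nothing.\<close>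
  have "c \<in> {0, 1, 2, 3, 4, 5, 6, 7, 8} \<or> c \<in> {9, 10} \<or> c \<in> {12, 13, 14, 15, 16} \<or> c = 17"
    using assms unfolding insert_iff empty_iff by presburger
  then consider "c \<in> {0, 1, 2, 3, 4, 5, 6, 7, 8}" | "c \<in> {9, 10}" | "c \<in> {12, 13, 14, 15, 16}" | "c = 17"
    by blast
  then show ?thesis
  proof cases
    case 1
    \<comment> \<open>The instantiation follows the order \<open>q\<close>, \<open>a\<close>,
      \<open>r\<close>, \<open>s\<close>, \<open>u\<close>, \<open>b\<close>, \<open>c\<close>. In
      the four cases the cutting entry 0 plays 1, k + 4, k + 5 and k + 6.\<close>
    then show ?thesis
      unfolding upt_18 by (intro pattern_labelsI[of 13 9 15 14 16 0 12])
        (auto simp: insert_pin_def skeleton_def)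
  next
    case 2
    then show ?thesis
      unfolding upt_18 by (intro pattern_labelsI[of 7 5 11 0 12 3 6])
        (auto simp: insert_pin_def skeleton_def)
  next
    case 3
    then show ?thesis
      unfolding upt_18 by (intro pattern_labelsI[of 10 5 0 12 17 4 8])
        (auto simp: insert_pin_def skeleton_def)
  next
    case 4
    then show ?thesis
      unfolding upt_18 by (intro pattern_labelsI[of 7 5 14 10 0 3 6])
        (auto simp: insert_pin_def skeleton_def)
  qed
qed

lemma pattern_labels_horizontal:
  assumes "c \<le> 17" "c \<noteq> 11"
  shows "pattern_labels (insert_pin skeleton c) (insert_pin [1..<18] 11)"
proof -
  have "c \<in> {0, 1, 2} \<or> c \<in> {3, 4, 5} \<or> c \<in> {6, 7, 8, 9, 10} \<or> c = 12 \<or> c \<in> {13, 14, 15, 16, 17}"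
    using assms unfolding insert_iff empty_iff by presburger
  then consider "c \<in> {0, 1, 2}" | "c \<in> {3, 4, 5}" | "c \<in> {6, 7, 8, 9, 10}" | "c = 12"
    | "c \<in> {13, 14, 15, 16, 17}"
    by blast
  then show ?thesis
  proof cases
    case 1
    \<comment> \<open>Now \<open>c\<close> counts the labels to the left of the cutting entry, which
      plays 2, k + 4, k + 5, k + 4 and 3 in the five cases.\<close>
    then show ?thesis
      unfolding upt_18 by (intro pattern_labelsI[of 13 0 15 14 16 10 12])
        (auto simp: insert_pin_def skeleton_def)
  next
    case 2
    then show ?thesis
      unfolding upt_18 by (intro pattern_labelsI[of 9 2 13 0 14 1 3])
        (auto simp: insert_pin_def skeleton_def)
  next
    case 3
    then show ?thesis
      unfolding upt_18 by (intro pattern_labelsI[of 7 5 0 11 12 3 6])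
        (auto simp: insert_pin_def skeleton_def)
  next
    case 4
    then show ?thesis
      unfolding upt_18 by (intro pattern_labelsI[of 10 5 12 0 17 4 8])
        (auto simp: insert_pin_def skeleton_def)
  next
    case 5
    then show ?thesis
      unfolding upt_18 by (intro pattern_labelsI[of 13 9 15 14 16 3 0])
        (auto simp: insert_pin_def skeleton_def)
  qed
qed


section \<open>The inflation avoids the pattern\<close>

definition up :: "nat \<times> nat \<Rightarrow> nat \<times> nat \<Rightarrow> bool" where
  "up d e \<longleftrightarrow> fst d \<le> fst e \<and> snd d \<le> snd e"

text \<open>Strict in both coordinates, because blocks are increasing and two entries in decreasing
  order cannot share one.\<close>

definition down :: "nat \<times> nat \<Rightarrow> nat \<times> nat \<Rightarrow> bool" where
  "down d e \<longleftrightarrow> fst d < fst e \<and> snd e < snd d"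

definition skeleton_points :: "(nat \<times> nat) list" where
  "skeleton_points = enumerate 0 skeleton"

text \<open>
  Two entries of the pattern in increasing order may fall into the same block of the inflation,
  hence the weak inequalities in \<open>up\<close>.  The order of the quantifiers keeps the search small.
\<close>

lemma skeleton_avoids:
  "\<forall>r\<in>set skeleton_points. \<forall>s\<in>set skeleton_points. down r s \<longrightarrow>
    (\<forall>u\<in>set skeleton_points. up r u \<and> up s u \<longrightarrow>
    (\<forall>b\<in>set skeleton_points. down s b \<and> down u b \<longrightarrow>
    (\<forall>c\<in>set skeleton_points. up b c \<and> down s c \<and> down u c \<longrightarrow>
    (\<forall>a\<in>set skeleton_points. up a s \<and> down a b \<and> up a c \<longrightarrow>
    (\<forall>q\<in>set skeleton_points. \<not> (up a q \<and> up q r \<and> up q s \<and> down q c))))))"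
  unfolding skeleton_points_def skeleton_def by (simp add: up_def down_def)

definition skeleton_index :: "nat \<Rightarrow> nat" where
  "skeleton_index v = length (takeWhile (\<lambda>w. w \<noteq> v) skeleton)"

text \<open>Contracts each block to the skeleton entry that it inflates.\<close>

definition point :: "nat \<Rightarrow> nat \<Rightarrow> nat \<times> nat" where
  "point k z = (skeleton_index (z div (2 * k)), z div (2 * k))"

lemma skeleton_index_sorted: "sorted_wrt (\<lambda>v w. skeleton_index v < skeleton_index w) skeleton"
  unfolding skeleton_index_def by (simp add: skeleton_def)

lemma div_block:
  assumes "k \<ge> 1" "x \<in> set (block k v)"
  shows "x div (2 * k) = v"
  using assms by (intro div_nat_eqI) (auto simp: block_def split: if_splits)

lemma point_inflation:
  assumes "k \<ge> 1" "z \<in> set (inflation k)"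
  shows "point k z \<in> set skeleton_points"
proof -
  obtain v where "v \<in> set skeleton" "z div (2 * k) = v"
    using assms(2) div_block[OF assms(1)] by (auto simp: inflation_def)
  moreover have "\<forall>v\<in>set skeleton. (skeleton_index v, v) \<in> set skeleton_points"
    by (simp add: skeleton_points_def skeleton_index_def skeleton_def)
  ultimately show ?thesis
    by (simp add: point_def)
qed

text \<open>Blocks follow the order of the skeleton, and within a block the orders of position and
  value agree.\<close>

lemma inflation_sorted:
  assumes "k \<ge> 1"
  shows "sorted_wrt (\<lambda>z z'. skeleton_index (z div (2 * k)) < skeleton_index (z' div (2 * k)) \<or>
    z div (2 * k) = z' div (2 * k) \<and> z < z') (inflation k)" (is "sorted_wrt ?R _")
  unfolding inflation_def sorted_wrt_concat_map
proof (intro conjI ballI)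
  fix v
  have "sorted_wrt (<) (block k v)"
    by (simp add: block_def)
  then show "sorted_wrt ?R (block k v)"
    by (rule sorted_wrt_mono_rel[rotated]) (simp add: div_block[OF assms])
next
  show "sorted_wrt (\<lambda>v w. \<forall>x\<in>set (block k v). \<forall>y\<in>set (block k w). ?R x y) skeleton"
    by (rule sorted_wrt_mono_rel[OF _ skeleton_index_sorted]) (simp add: div_block[OF assms])
qed

lemma distinct_inflation: "k \<ge> 1 \<Longrightarrow> distinct (inflation k)"
  using inflation_sorted[of k] unfolding distinct_conv_nth sorted_wrt_iff_nth_less
  by (metis less_irrefl nat_neq_iff)

text \<open>Contracting the blocks sends an occurrence, with only the first entry of its run kept,
  to seven skeleton points. Increasing pairs become \<open>up\<close>, decreasing pairs
  \<open>down\<close>, and \<open>skeleton_avoids\<close> rules out this configuration.\<close>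

lemma inflation_avoids_pattern:
  assumes "k \<ge> 1"
  shows "\<not> perm_contained (pattern k) (inflation k)"
proof
  assume "perm_contained (pattern k) (inflation k)"
  then obtain ys where ys: "subseq ys (inflation k)" "same_order (pattern k) ys"
    unfolding perm_contained_def by blast
  have len: "length ys = k + 6"
    using ys(2) by (simp add: same_order_def pattern_def)
  define d where "d i = point k (ys ! i)" for i
  have mem: "d i \<in> set skeleton_points" if "i < k + 6" for i
    using that len subseq_set[OF ys(1)] point_inflation[OF assms] unfolding d_def by (metis nth_mem subsetD)
  have order: "ys ! i < ys ! j \<longleftrightarrow> pattern k ! i < pattern k ! j" if "i < k + 6" "j < k + 6" for i j
    using ys(2) that len unfolding same_order_def by auto
  have before: "skeleton_index (ys ! i div (2 * k)) < skeleton_index (ys ! j div (2 * k)) \<or>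
      ys ! i div (2 * k) = ys ! j div (2 * k) \<and> ys ! i < ys ! j" if "i < j" "j < k + 6" for i j
    using sorted_wrt_subseq[OF ys(1) inflation_sorted[OF assms]] that len
    unfolding sorted_wrt_iff_nth_less by auto
  have up: "up (d i) (d j)" if "i < j" "j < k + 6" "pattern k ! i < pattern k ! j" for i j
    using before[of i j] order[of i j] that
    by (auto simp: up_def d_def point_def intro: div_le_mono)
  have down: "down (d i) (d j)" if ij: "i < j" "j < k + 6" and "pattern k ! j < pattern k ! i" for i j
  proof -
    have "ys ! j < ys ! i"
      using order[of j i] that by simp
    then have *: "skeleton_index (ys ! i div (2 * k)) < skeleton_index (ys ! j div (2 * k))"
      and "ys ! j div (2 * k) \<le> ys ! i div (2 * k)"
      using before[OF ij] by (auto intro: div_le_mono)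
    moreover from * have "ys ! j div (2 * k) \<noteq> ys ! i div (2 * k)"
      by auto
    ultimately show ?thesis
      by (simp add: down_def d_def point_def)
  qed
  \<comment> \<open>Indices 0, 1 and k + 1 to k + 5 correspond to \<open>a\<close>,
    \<open>q\<close>, \<open>r\<close>, \<open>s\<close>, \<open>u\<close>, \<open>b\<close>,
    \<open>c\<close> in \<open>skeleton_avoids\<close>; index 1 holds 4 because the run is
    nonempty.\<close>
  have nth: "pattern k ! 0 = 2" "pattern k ! 1 = 4" "pattern k ! (k + 1) = k + 5"
    "pattern k ! (k + 2) = k + 4" "pattern k ! (k + 3) = k + 6" "pattern k ! (k + 4) = 1"
    "pattern k ! (k + 5) = 3"
    using assms by (simp_all add: pattern_def nth_append nth_Cons')
  have "down (d (k + 1)) (d (k + 2))" "up (d (k + 1)) (d (k + 3))" "up (d (k + 2)) (d (k + 3))"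
    "down (d (k + 2)) (d (k + 4))" "down (d (k + 3)) (d (k + 4))" "up (d (k + 4)) (d (k + 5))"
    "down (d (k + 2)) (d (k + 5))" "down (d (k + 3)) (d (k + 5))" "up (d 0) (d (k + 2))"
    "down (d 0) (d (k + 4))" "up (d 0) (d (k + 5))" "up (d 0) (d 1)" "up (d 1) (d (k + 1))"
    "up (d 1) (d (k + 2))" "down (d 1) (d (k + 5))"
    using assms by (auto simp: nth nth[simplified] intro!: up down)
  moreover have "d (k + 1) \<in> set skeleton_points" "d (k + 2) \<in> set skeleton_points"
    "d (k + 3) \<in> set skeleton_points" "d (k + 4) \<in> set skeleton_points"
    "d (k + 5) \<in> set skeleton_points" "d 0 \<in> set skeleton_points" "d 1 \<in> set skeleton_points"
    using assms by (auto intro!: mem)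
  ultimately show False
    using skeleton_avoids by blast
qed

section \<open>Simple permutations containing the inflation\<close>

lemma sorted_neighbours:
  assumes "sorted_wrt R (concat (map B (L1 @ m # n # L2)))" "B m = [x]" "B n = [y]"
  shows "R x y"
    and "v \<in> set (L1 @ [m]) \<Longrightarrow> w \<in> set (B v) \<Longrightarrow> w = x \<or> R w x"
    and "v \<in> set (n # L2) \<Longrightarrow> w \<in> set (B v) \<Longrightarrow> w = y \<or> R y w"
  using assms by (auto simp: sorted_wrt_append)

text \<open>Simplicity gives an entry \<open>p\<close> cutting the rectangle of the images of 11 and
  12. In one coordinate \<open>p\<close> lies in the gap between them; in the other, splitting the
  blocks finds its gap, which is a different one. The tables of labels then give a copy of the
  pattern.\<close>

lemma simple_extension_contains_pattern:
  assumes "k \<ge> 1" "simple_perm \<tau>" "perm_contained (inflation k) \<tau>"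
  shows "perm_contained (pattern k) \<tau>"
proof -
  obtain \<phi> where \<phi>: "sorted_wrt (<) (map \<phi> (inflation k))" "\<phi> ` set (inflation k) \<subseteq> {..<length \<tau>}"
      "strict_mono_on (set (inflation k)) (\<lambda>v. \<tau> ! \<phi> v)"
    using assms(3) perm_contained_iff[OF distinct_inflation[OF assms(1)]] by blast
  \<comment> \<open>\<open>B v\<close> lists the positions in \<tau> of the image of block
    \<open>v\<close>; \<open>less\<close> compares positions by the values they hold.\<close>
  define B where "B v = map \<phi> (block k v)" for v
  define V :: "nat list" where "V = [1..<18]"
  define less where "less i j \<longleftrightarrow> \<tau> ! i < \<tau> ! j" for i j
  have set_V: "set V = set skeleton"
    by (simp add: V_def set_skeleton)
  have length: "length skeleton = 17" "length V = 17"
    by (simp_all add: skeleton_def V_def)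
  have zero: "0 \<notin> set skeleton"
    by (simp add: set_skeleton)
  \<comment> \<open>The label 11 comes eleventh both by position and by value, so 11 is the gap
    between 11 and 12 in both lists.\<close>
  have take_drop: "take 11 skeleton = [2, 9, 13, 15, 5, 7, 14, 1, 16, 10] @ [11]"
      "drop 11 skeleton = 12 # [3, 6, 17, 4, 8]"
      "take 11 V = [1, 2, 3, 4, 5, 6, 7, 8, 9, 10] @ [11]"
      "drop 11 V = 12 # [13, 14, 15, 16, 17]"
    unfolding skeleton_def V_def upt_18 by simp_all
  have split: "skeleton = [2, 9, 13, 15, 5, 7, 14, 1, 16, 10] @ 11 # 12 # [3, 6, 17, 4, 8]"
      "V = [1, 2, 3, 4, 5, 6, 7, 8, 9, 10] @ 11 # 12 # [13, 14, 15, 16, 17]"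
    unfolding skeleton_def V_def upt_18 by simp_all
  have pos: "sorted_wrt (<) (concat (map B skeleton))"
    using \<phi>(1) by (simp add: inflation_def B_def[abs_def] map_concat comp_def)
  have val: "sorted_wrt less (concat (map B V))"
  proof -
    have "sorted_wrt (<) (concat (map (block k) V))"
      unfolding sorted_wrt_concat_map
    proof (intro conjI ballI)
      have "x < y" if "x \<in> set (block k v)" "y \<in> set (block k w)" "v < w" for x y v w
        using that div_block[OF assms(1)] div_le_mono[of y x "2 * k"] by (metis not_le)
      then show "sorted_wrt (\<lambda>v w. \<forall>x\<in>set (block k v). \<forall>y\<in>set (block k w). x < y) V"
        unfolding V_def by (intro sorted_wrt_mono_rel[OF _ sorted_wrt_upt]) auto
    qed (simp add: block_def)
    moreover have "less (\<phi> v) (\<phi> w)"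
      if "v \<in> set (concat (map (block k) V))" "w \<in> set (concat (map (block k) V))" "v < w" for v w
      using strict_mono_onD[OF \<phi>(3)] that by (simp add: less_def inflation_def set_V)
    ultimately have "sorted_wrt (\<lambda>v w. less (\<phi> v) (\<phi> w)) (concat (map (block k) V))"
      by (rule sorted_wrt_mono_rel[rotated])
    then have "sorted_wrt less (map \<phi> (concat (map (block k) V)))"
      by (simp add: sorted_wrt_map)
    then show ?thesis
      by (simp add: B_def[abs_def] map_concat comp_def)
  qed
  have bound: "set (B v) \<subseteq> {..<length \<tau>}" if "v \<in> set skeleton" for v
    using \<phi>(2) that by (auto simp: B_def inflation_def)
  have len_B: "length (B v) = (if v = 11 \<or> v = 12 then 1 else 2 * k)" for v
    by (simp add: B_def block_def)
  obtain x y where xy: "B 11 = [x]" "B 12 = [y]"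
    using len_B[of 11] len_B[of 12] by (auto simp: length_Suc_conv)
  note P_near = sorted_neighbours[OF pos[unfolded split(1)] xy, folded take_drop(1,2)]
  note V_near = sorted_neighbours[OF val[unfolded split(2)] xy, folded take_drop(3,4)]
  have "x < y" "\<tau> ! x < \<tau> ! y"
    using P_near(1) V_near(1) by (simp_all add: less_def)
  have "y < length \<tau>"
    using bound[of 12] xy by (simp add: set_skeleton)
  have distinct: "distinct \<tau>"
    using assms(2) by (simp add: simple_perm_def perms_iff)
  have in_parts: "v \<in> set (take 11 L) \<or> v \<in> set (drop 11 L)" if "v \<in> set L" for v and L :: "nat list"
    using that by (metis Un_iff append_take_drop_id set_append)

  \<comment> \<open>Common end of both cases: \<open>c\<close> and \<open>d\<close> are the gaps of
    \<open>p\<close> by position and by value, and \<open>B'\<close> holds the halves that were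
    kept.\<close>
  have combine: "perm_contained (pattern k) \<tau>"
    if "p < length \<tau>" and labels: "pattern_labels (insert_pin skeleton c) (insert_pin V d)"
      and sub: "\<And>v. v \<in> set skeleton \<Longrightarrow> subseq (B' v) (B v)"
      and ne: "\<And>v. v \<in> set skeleton \<Longrightarrow> B' v \<noteq> []"
      and len: "\<And>v. v \<in> set skeleton \<Longrightarrow> length (B v) \<noteq> 1 \<Longrightarrow> length (B' v) = k"
      and left: "\<And>v w. v \<in> set (take c skeleton) \<Longrightarrow> w \<in> set (B' v) \<Longrightarrow> w < p"
      and right: "\<And>v w. v \<in> set (drop c skeleton) \<Longrightarrow> w \<in> set (B' v) \<Longrightarrow> p < w"
      and low: "\<And>v w. v \<in> set (take d V) \<Longrightarrow> w \<in> set (B' v) \<Longrightarrow> less w p"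
      and high: "\<And>v w. v \<in> set (drop d V) \<Longrightarrow> w \<in> set (B' v) \<Longrightarrow> less p w"
    for p c d B'
  proof -
    have shrink: "sorted_wrt R (concat (map B' L))"
      if "sorted_wrt R (concat (map B L))" "set L = set skeleton" for R and L :: "nat list"
    proof (rule sorted_wrt_shrink_blocks[OF that(1)])
      show "set (B' v) \<subseteq> set (B v)" if "v \<in> set L" for v
        using subseq_set[OF sub] that \<open>set L = set skeleton\<close> by simp
      show "sorted_wrt R (B' v)" if "v \<in> set L" for v
        using sorted_wrt_subseq[OF sub] that \<open>set L = set skeleton\<close>
          \<open>sorted_wrt R (concat (map B L))\<close>
        unfolding sorted_wrt_concat_map by blast
    qed
    have P: "sorted_wrt (<) (concat (map (B'(0 := [p])) (insert_pin skeleton c)))"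
      by (rule insert_pin_sorted[OF shrink[OF pos refl] zero left right])
    have V: "sorted_wrt less (concat (map (B'(0 := [p])) (insert_pin V d)))"
      by (rule insert_pin_sorted[OF shrink[OF val set_V] _ low high]) (simp add: set_V zero)
    have V': "sorted_wrt (<) (map ((!) \<tau>) (concat (map (B'(0 := [p])) (insert_pin V d))))"
      using V unfolding sorted_wrt_map less_def .
    have "set skeleton = set (take c skeleton) \<union> set (drop c skeleton)"
      by (metis append_take_drop_id set_append)
    then have set_insert: "set (insert_pin skeleton c) = insert 0 (set skeleton)"
      by (auto simp: insert_pin_def)
    obtain a q r s u b c' where q: "q \<notin> {0, 11, 12}"
      and subs: "subseq [a, q, r, s, u, b, c'] (insert_pin skeleton c)"
        "subseq [b, a, c', q, s, r, u] (insert_pin V d)"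
      using labels unfolding pattern_labels_def by blast
    have "q \<in> set skeleton"
      using subseq_set[OF subs(1)] q set_insert by auto
    moreover have "length (B q) \<noteq> 1"
      using q len_B[of q] by simp
    ultimately have "length ((B'(0 := [p])) q) = k"
      using len q by simp
    moreover have "(B'(0 := [p])) v \<noteq> []" if "v \<in> set (insert_pin skeleton c)" for v
      using that ne unfolding set_insert by auto
    moreover have "set ((B'(0 := [p])) v) \<subseteq> {..<length \<tau>}" if "v \<in> set (insert_pin skeleton c)" for v
    proof (cases "v = 0")
      case False
      then have "v \<in> set skeleton"
        using that unfolding set_insert by simp
      then show ?thesis
        using subseq_set[OF sub] bound False by simp blast
    qed (use \<open>p < length \<tau>\<close> in simp)
    ultimately show ?thesis
      by (rule perm_contained_pattern_blocks[OF P V' subs, rotated 2])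
  qed

  \<comment> \<open>Gap 11 would put \<open>p\<close> between \<open>x\<close> and \<open>y\<close>
    in the coordinate \<open>R\<close>, where the cut places it outside.\<close>
  have cell: "c \<noteq> 11"
    if "\<not> (R x p \<and> R p y)" and sub: "\<And>v. v \<in> set skeleton \<Longrightarrow> subseq (B' v) (B v)"
      and ne: "\<And>v. v \<in> set skeleton \<Longrightarrow> B' v \<noteq> []"
      and left: "\<And>v w. v \<in> set (take c L) \<Longrightarrow> w \<in> set (B' v) \<Longrightarrow> R w p"
      and right: "\<And>v w. v \<in> set (drop c L) \<Longrightarrow> w \<in> set (B' v) \<Longrightarrow> R p w"
      and L: "11 \<in> set (take 11 L)" "12 \<in> set (drop 11 L)"
    for R p c B' and L :: "nat list"
  proof
    assume "c = 11"
    have "11 \<in> set skeleton" "12 \<in> set skeleton"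
      by (simp_all add: set_skeleton)
    then have "x \<in> set (B' 11)" "y \<in> set (B' 12)"
      using subseq_set[OF sub, of 11] subseq_set[OF sub, of 12] ne[of 11] ne[of 12] xy
      by (cases "B' 11"; cases "B' 12"; auto)+
    then show False
      using that(1) left right L \<open>c = 11\<close> by blast
  qed

  have len_cases: "length (B v) = 1 \<or> length (B v) = 2 * k" for v
    by (simp add: len_B)
  \<comment> \<open>The label 2 precedes 11 in the skeleton, so an entry of its block lies left of
    \<open>x\<close> and shows that the rectangle is proper.\<close>
  obtain z where z: "z \<in> set (B 2)"
    using len_B[of 2] assms(1) by (cases "B 2") auto
  have "z \<noteq> x \<Longrightarrow> z < x" "z < length \<tau>"
    using P_near(2)[of 2 z] z bound[of 2] by (auto simp: take_drop set_skeleton)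
  moreover have "less z x"
    using val z xy unfolding split(2) by (simp add: sorted_wrt_append)
  ultimately have z: "z < length \<tau>" "z \<notin> {x..y}"
    by (cases "z = x"; auto simp: less_def)+
  from assms(2) \<open>x < y\<close> \<open>y < length \<tau>\<close> \<open>\<tau> ! x < \<tau> ! y\<close> z show ?thesis
  proof (cases rule: simple_perm_cut)
    \<comment> \<open>\<open>p\<close> lies between \<open>x\<close> and \<open>y\<close> in
      position, so blocks can be split only by value.\<close>
    case (1 p)
    have p: "p < length \<tau>"
      using 1 \<open>y < length \<tau>\<close> by simp
    have neq: "\<tau> ! w \<noteq> \<tau> ! p" if "v \<in> set V" "w \<in> set (B v)" for v w
    proof -
      have v: "v \<in> set skeleton"
        using that set_V by simp
      then have "w \<noteq> p"
        using in_parts[OF v] P_near(2,3)[OF _ that(2)] 1 by auto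
      moreover have "w < length \<tau>"
        using bound[OF v] that by auto
      ultimately show ?thesis
        using distinct p by (simp add: nth_eq_iff_index_eq)
    qed
    have val': "sorted_wrt (\<lambda>i j. \<tau> ! i < \<tau> ! j) (concat (map B V))"
      using val by (simp add: less_def[abs_def])
    obtain B' d where B': "d \<le> length V"
        "\<And>v. v \<in> set V \<Longrightarrow> subseq (B' v) (B v)" "\<And>v. v \<in> set V \<Longrightarrow> B' v \<noteq> []"
        "\<And>v. v \<in> set V \<Longrightarrow> length (B v) \<noteq> 1 \<Longrightarrow> length (B' v) = k"
        "\<And>v w. v \<in> set (take d V) \<Longrightarrow> w \<in> set (B' v) \<Longrightarrow> \<tau> ! w < \<tau> ! p"
        "\<And>v w. v \<in> set (drop d V) \<Longrightarrow> w \<in> set (B' v) \<Longrightarrow> \<tau> ! p < \<tau> ! w"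
      by (rule split_blocks[OF val' assms(1) len_cases], erule (1) neq, rule that)
    have inB: "w \<in> set (B v)" if "v \<in> set skeleton" "w \<in> set (B' v)" for v w
      using subseq_set[OF B'(2)[of v]] that set_V by blast
    have "d \<noteq> 11"
      by (rule cell[of less p B' d V]) (use 1 B' set_V take_drop in \<open>auto simp: less_def\<close>)
    then have "pattern_labels (insert_pin skeleton 11) (insert_pin V d)"
      using pattern_labels_vertical B'(1) by (simp add: length V_def)
    moreover have "w < p" if "v \<in> set (take 11 skeleton)" "w \<in> set (B' v)" for v w
      using P_near(2)[of v w] that 1 inB[OF in_set_takeD[OF that(1)]] by auto
    moreover have "p < w" if "v \<in> set (drop 11 skeleton)" "w \<in> set (B' v)" for v w
      using P_near(3)[of v w] that 1 inB[OF in_set_dropD[OF that(1)]] by auto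
    ultimately show ?thesis
      using combine[OF p, of 11 d B'] B' unfolding set_V less_def by blast
  next
    \<comment> \<open>\<open>p\<close> lies between \<open>x\<close> and \<open>y\<close> in value,
      so blocks can be split only by position.\<close>
    case (2 p)
    have neq: "w \<noteq> p" if "v \<in> set skeleton" "w \<in> set (B v)" for v w
      using in_parts[of v V] V_near(2,3)[OF _ that(2)] that set_V 2 by (auto simp: less_def)
    obtain B' c where B': "c \<le> length skeleton"
        "\<And>v. v \<in> set skeleton \<Longrightarrow> subseq (B' v) (B v)" "\<And>v. v \<in> set skeleton \<Longrightarrow> B' v \<noteq> []"
        "\<And>v. v \<in> set skeleton \<Longrightarrow> length (B v) \<noteq> 1 \<Longrightarrow> length (B' v) = k"
        "\<And>v w. v \<in> set (take c skeleton) \<Longrightarrow> w \<in> set (B' v) \<Longrightarrow> w < p"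
        "\<And>v w. v \<in> set (drop c skeleton) \<Longrightarrow> w \<in> set (B' v) \<Longrightarrow> p < w"
      \<comment> \<open>The entries of the blocks are positions already, hence the identity for
        \<kappa>.\<close>
      by (rule split_blocks[where \<kappa> = "\<lambda>i. i", OF pos assms(1) len_cases], erule (1) neq, rule that)
    have inB: "w \<in> set (B v)" if "v \<in> set skeleton" "w \<in> set (B' v)" for v w
      using subseq_set[OF B'(2)[of v]] that by blast
    have "c \<noteq> 11"
      by (rule cell[of "(<)" p B' c skeleton]) (use 2 B' take_drop in auto)
    then have "pattern_labels (insert_pin skeleton c) (insert_pin V 11)"
      using pattern_labels_horizontal B'(1) by (simp add: length V_def)
    moreover have "less w p" if "v \<in> set (take 11 V)" "w \<in> set (B' v)" for v w
      using V_near(2)[of v w] that 2 inB[OF in_set_takeD[OF that(1), unfolded set_V]]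
      by (auto simp: less_def)
    moreover have "less p w" if "v \<in> set (drop 11 V)" "w \<in> set (B' v)" for v w
      using V_near(3)[of v w] that 2 inB[OF in_set_dropD[OF that(1), unfolded set_V]]
      by (auto simp: less_def)
    ultimately show ?thesis
      using combine[OF 2(1), of c 11 B'] B' by blast
  qed
qed

section \<open>Infinitely many deflatable principal classes\<close>

lemma deflatable_Av_pattern:
  assumes "k \<ge> 1"
  shows "deflatable (Av (pattern k))"
proof -
  have "inflation k \<noteq> []"
    using assms by (simp add: inflation_def skeleton_def block_def)
  \<comment> \<open>\<open>Av\<close> consists of elements of \<open>perms\<close>, so the
    standardization \<sigma> stands in for the inflation; each contains the other.\<close>
  then obtain \<sigma> where \<sigma>: "\<sigma> \<in> perms" "same_order \<sigma> (inflation k)"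
    using ex_standardization[OF distinct_inflation[OF assms]] by blast
  have to_\<sigma>: "perm_contained (inflation k) \<sigma>" and from_\<sigma>: "perm_contained \<sigma> (inflation k)"
    using perm_contained_same_order \<sigma>(2) same_order_sym by blast+
  show ?thesis
  proof (rule deflatableI[OF perm_class_Av])
    show "\<sigma> \<in> Av (pattern k)"
      using \<sigma>(1) from_\<sigma> inflation_avoids_pattern[OF assms] perm_contained_trans
      unfolding Av_def by blast
    show "\<not> perm_contained \<sigma> \<tau>" if "\<tau> \<in> simples (Av (pattern k))" for \<tau>
    proof
      assume "perm_contained \<sigma> \<tau>"
      then have "perm_contained (inflation k) \<tau>"
        using perm_contained_trans to_\<sigma> by blast
      then show False
        using simple_extension_contains_pattern[OF assms] that by (auto simp: simples_def Av_def)
    qed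
  qed
qed

theorem theorem4p3:
  "infinite {\<pi>. \<pi> \<in> perms \<and> deflatable (Av \<pi>)}"
proof (rule infinite_super)
  show "range (\<lambda>k. pattern (Suc k)) \<subseteq> {\<pi>. \<pi> \<in> perms \<and> deflatable (Av \<pi>)}"
    using pattern_in_perms deflatable_Av_pattern by auto
  \<comment> \<open>Patterns for different parameters differ in length.\<close>
  have "inj (\<lambda>k. pattern (Suc k))"
    by (rule injI) (auto simp: pattern_def dest: arg_cong[where f = length])
  then show "infinite (range (\<lambda>k. pattern (Suc k)))"
    using finite_imageD infinite_UNIV_nat by blast
qed

end
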